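(* Let $1\le K\le L$ be integers, $p\in(0,1]$ and $\Delta\in(0,p)$, and let $B_{\mathrm{LB}}(L,K,p,\Delta)$ be the cascading bandit with ground set $E=\{1,\dots,L\}$, $K$ recommended items, and attraction probabilities $$\bar w(e)=\begin{cases}p & e\le K,\\ p-\Delta & K<e\le L.\end{cases}$$ Then the expected $n$-step regret $R(n)$ on $B_{\mathrm{LB}}(L,K,p,\Delta)$ of any consistent algorithm satisfies $$\liminf_{n\to\infty}\frac{R(n)}{\log n}\;\ge\;\frac{(L-K)\,\Delta\,(1-p)^{K-1}}{D_{\mathrm{KL}}(p-\Delta\,\|\,p)} .$$
   Context: **Cascading bandit.** $E=\{1,\dots,L\}$ is a ground set of $L$ items, $1\le K\le L$, and $\Pi_K(E)$ is the set of $K$-permutations of $E$ (ordered lists of $K$ distinct items). $P$ is a distribution on $\{0,1\}^E$ that is a product of Bernoulli distributions, the coordinate $e$ having mean $\bar w(e)\in[0,1]$ (the attraction probability of $e$). The weights $\mathbf w_1,\mathbf w_2,\dots$ are i.i.d. from $P$. At each time $t$ the agent, which does not know $\bar w$, recommends a list $\mathbf A_t=(\mathbf a^t_1,\dots,\mathbf a^t_K)\in\Pi_K(E)$, computed from its observations before time $t$, and then observes the click $\mathbf C_t=\min\{1\le k\le K:\mathbf w_t(\mathbf a^t_k)=1\}$, with $\min\emptyset=\infty$. **Regret.** For $A=(a_1,\dots,a_K)$ and $w\in[0,1]^E$ let $f(A,w)=1-\prod_{k=1}^K(1-w(a_k))$. Let $A^\ast\in\arg\max_{A\in\Pi_K(E)}f(A,\bar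 w)$ and $R(A,w)=f(A^\ast,w)-f(A,w)$. The expected $n$-step regret is $R(n)=\mathbb E\big[\sum_{t=1}^nR(\mathbf A_t,\mathbf w_t)\big]$. A list $A$ is suboptimal if $f(A,\bar w)<f(A^\ast,\bar w)$. **Consistency.** An algorithm is *consistent* if for any cascading bandit (any attraction probabilities $\bar w$), any suboptimal list $A$, and any $\alpha>0$, $\mathbb E[\mathbf T_n(A)]=o(n^\alpha)$ as $n\to\infty$, where $\mathbf T_n(A)$ is the number of times that list $A$ is recommended in $n$ steps. **KL divergence.** $D_{\mathrm{KL}}(p\,\|\,q)=p\log\frac pq+(1-p)\log\frac{1-p}{1-q}$ is the Kullback–Leibler divergence between Bernoulli distributions with means $p$ and $q$ (value $+\infty$ where appropriate, and $1/\infty=0$). *)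

theory Defs
  imports "HOL-Probability.Probability" "HOL-Library.Landau_Symbols"
begin

definition klists :: "nat \<Rightarrow> nat \<Rightarrow> nat list set" where
  "klists L K = {A. length A = K \<and> distinct A \<and> set A \<subseteq> {1..L}}"

definition reward :: "nat list \<Rightarrow> (nat \<Rightarrow> real) \<Rightarrow> real" where
  "reward A w = 1 - (\<Prod>a\<leftarrow>A. 1 - w a)"

definition attraction_probs :: "nat \<Rightarrow> (nat \<Rightarrow> real) \<Rightarrow> bool" where
  "attraction_probs L w \<longleftrightarrow> (\<forall>e\<in>{1..L}. 0 \<le> w e \<and> w e \<le> 1)"

definition optimal_list :: "nat \<Rightarrow> nat \<Rightarrow> (nat \<Rightarrow> real) \<Rightarrow> nat list \<Rightarrow> bool" where
  "optimal_list L K w A \<longleftrightarrow> is_arg_max (\<lambda>B. reward B w) (\<lambda>B. B \<in> klists L K) A"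

definition suboptimal_list :: "nat \<Rightarrow> nat \<Rightarrow> (nat \<Rightarrow> real) \<Rightarrow> nat list \<Rightarrow> bool" where
  "suboptimal_list L K w A \<longleftrightarrow>
     A \<in> klists L K \<and> (\<exists>Astar. optimal_list L K w Astar \<and> reward A w < reward Astar w)"

definition weights_pmf :: "nat \<Rightarrow> (nat \<Rightarrow> real) \<Rightarrow> (nat \<Rightarrow> bool) pmf" where
  "weights_pmf L w = Pi_pmf {1..L} False (\<lambda>e. bernoulli_pmf (w e))"

text \<open>Positions count from 1 while list indices count from 0; on \<^typ>\<open>enat\<close> the
  infimum of the empty set is \<open>\<infinity>\<close>.\<close>

definition click :: "nat list \<Rightarrow> (nat \<Rightarrow> bool) \<Rightarrow> enat" where
  "click A v = (INF k \<in> {k \<in> {1..length A}. v (A ! (k - 1))}. enat k)"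

text \<open>An algorithm may randomize: from the observed lists and clicks so far (oldest first) it
  produces a distribution over the next list. Deterministic algorithms are those whose values
  are of the form \<open>return_pmf A\<close>. The time step is recoverable as the length of the history.\<close>

type_synonym algorithm = "(nat list \<times> enat) list \<Rightarrow> nat list pmf"

definition valid_algorithm :: "nat \<Rightarrow> nat \<Rightarrow> algorithm \<Rightarrow> bool" where
  "valid_algorithm L K \<pi> \<longleftrightarrow> (\<forall>h. set_pmf (\<pi> h) \<subseteq> klists L K)"

text \<open>A trajectory records, for each step, the recommended list and the full realized weight
  vector; the algorithm only gets to see the list and its click.\<close>

definition observe :: "(nat list \<times> (nat \<Rightarrow> bool)) list \<Rightarrow> (nat list \<times> enat) list" where
  "observe h = map (\<lambda>(A, v). (A, click A v)) h"

primrec trajectory_pmf ::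
  "nat \<Rightarrow> (nat \<Rightarrow> real) \<Rightarrow> algorithm \<Rightarrow> nat \<Rightarrow> (nat list \<times> (nat \<Rightarrow> bool)) list pmf" where
  "trajectory_pmf L w \<pi> 0 = return_pmf []"
| "trajectory_pmf L w \<pi> (Suc n) =
     do {
       h \<leftarrow> trajectory_pmf L w \<pi> n;
       A \<leftarrow> \<pi> (observe h);
       v \<leftarrow> weights_pmf L w;
       return_pmf (h @ [(A, v)])
     }"

definition expected_pulls ::
  "nat \<Rightarrow> (nat \<Rightarrow> real) \<Rightarrow> algorithm \<Rightarrow> nat list \<Rightarrow> nat \<Rightarrow> real" where
  "expected_pulls L w \<pi> A n =
     measure_pmf.expectation (trajectory_pmf L w \<pi> n) (\<lambda>h. real (count_list (map fst h) A))"

definition instant_regret :: "nat list \<Rightarrow> nat list \<Rightarrow> (nat \<Rightarrow> real) \<Rightarrow> real" where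
  "instant_regret Astar A w = reward Astar w - reward A w"

text \<open>The optimal list entering the regret is a parameter because it need not be unique.\<close>

definition expected_regret ::
  "nat \<Rightarrow> (nat \<Rightarrow> real) \<Rightarrow> algorithm \<Rightarrow> nat list \<Rightarrow> nat \<Rightarrow> real" where
  "expected_regret L w \<pi> Astar n =
     measure_pmf.expectation (trajectory_pmf L w \<pi> n)
       (\<lambda>h. \<Sum>(A, v)\<leftarrow>h. instant_regret Astar A (\<lambda>e. of_bool (v e)))"

definition consistent :: "nat \<Rightarrow> nat \<Rightarrow> algorithm \<Rightarrow> bool" where
  "consistent L K \<pi> \<longleftrightarrow>
     (\<forall>w. attraction_probs L w \<longrightarrow>
       (\<forall>A. suboptimal_list L K w A \<longrightarrow>
         (\<forall>\<alpha>>0. (\<lambda>n. expected_pulls L w \<pi> A n) \<in> o(\<lambda>n. real n powr \<alpha>))))"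

text \<open>The convention \<open>0 * ln (0 / q) = 0\<close> is automatic in HOL; division by zero is not, hence
  the explicit infinite cases.\<close>

definition bernoulli_KL :: "real \<Rightarrow> real \<Rightarrow> ereal" where
  "bernoulli_KL p q =
     (if (p \<noteq> 0 \<and> q = 0) \<or> (p \<noteq> 1 \<and> q = 1) then \<infinity>
      else ereal (p * ln (p / q) + (1 - p) * ln ((1 - p) / (1 - q))))"

definition LB_probs :: "nat \<Rightarrow> real \<Rightarrow> real \<Rightarrow> nat \<Rightarrow> real" where
  "LB_probs K p \<Delta> e = (if e \<le> K then p else p - \<Delta>)"

end

theory Submission
  imports Defs "HOL-Real_Asymp.Real_Asymp"
begin

text \<open>
  Each recommendation of a suboptimal item \<open>e\<close> costs at least \<open>\<Delta> (1 - p)^(K - 1)\<close>, so it suffices that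
  \<open>e\<close> is recommended at least about \<open>ln n / KL(p - \<Delta>, p)\<close> times. Raise the attraction probability of
  \<open>e\<close> to some \<open>s > p\<close>: in the new bandit every list without \<open>e\<close> is suboptimal, so a consistent
  algorithm misses \<open>e\<close> only \<open>o(n^\<epsilon>)\<close> times, whereas in the original bandit it misses \<open>e\<close> almost always.
  The clicks reveal something about the weight of \<open>e\<close> only in steps that recommend \<open>e\<close>, so the two laws of
  the observations differ by a likelihood ratio that collects a factor only in those steps, and its
  expected negative logarithm is the expected number of recommendations of \<open>e\<close> times
  \<open>KL(p - \<Delta>, s)\<close>. This must be of order at least \<open>(1 - \<epsilon>)\<^sup>2 ln n\<close>; finally let \<open>s\<close> decrease to \<open>p\<close>.
\<close>

section \<open>Finitely supported expectations\<close>

lemma expectation_bind_pmf_finite: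
  fixes f :: "'b \<Rightarrow> real"
  assumes "finite (set_pmf p)" "\<And>x. x \<in> set_pmf p \<Longrightarrow> finite (set_pmf (g x))"
  shows "measure_pmf.expectation (p \<bind> g) f =
    measure_pmf.expectation p (\<lambda>x. measure_pmf.expectation (g x) f)"
  using assms
  by (subst pmf_expectation_bind[of "set_pmf p"], simp_all)
    (subst integral_measure_pmf[of "set_pmf p"], simp_all)

lemma expectation_cong:
  fixes f :: "'a \<Rightarrow> real"
  assumes "\<And>x. x \<in> set_pmf p \<Longrightarrow> f x = g x"
  shows "measure_pmf.expectation p f = measure_pmf.expectation p g"
  by (rule integral_cong_AE) (auto simp: AE_measure_pmf_iff assms)

lemma expectation_mono_finite:
  fixes f :: "'a \<Rightarrow> real"
  assumes "finite (set_pmf p)" "\<And>x. x \<in> set_pmf p \<Longrightarrow> f x \<le> g x"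
  shows "measure_pmf.expectation p f \<le> measure_pmf.expectation p g"
  by (rule integral_mono_AE)
    (auto simp: AE_measure_pmf_iff assms intro: integrable_measure_pmf_finite)

section \<open>Lists and weights\<close>

lemma finite_klists: "finite (klists L K)"
  by (rule finite_subset[OF _ finite_lists_length_eq[of "{1..L}" K]]) (auto simp: klists_def)

lemma klists_nonempty: "K \<le> L \<Longrightarrow> [1..<Suc K] \<in> klists L K"
  by (auto simp: klists_def)

lemma finite_set_weights_pmf: "finite (set_pmf (weights_pmf L w))"
proof -
  have "finite (PiE_dflt {1..L} False (\<lambda>_. UNIV :: bool set))"
    by (rule finite_PiE_dflt) auto
  moreover have "set_pmf (weights_pmf L w) \<subseteq> PiE_dflt {1..L} False (\<lambda>_. UNIV)"
    unfolding weights_pmf_def by (auto simp: set_Pi_pmf PiE_dflt_def)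
  ultimately show ?thesis by (rule rev_finite_subset)
qed

lemma integrable_weights_pmf: "integrable (measure_pmf (weights_pmf L w)) (f :: _ \<Rightarrow> real)"
  by (rule integrable_measure_pmf_finite[OF finite_set_weights_pmf])

text \<open>Conditioning on the weight of \<open>e\<close>. The law of the remaining coordinates
  does not involve \<open>w e\<close>, so bandits that differ only at \<open>e\<close> can be
  compared through the two outer coefficients.\<close>

lemma expectation_weights_pmf_split:
  fixes f :: "(nat \<Rightarrow> bool) \<Rightarrow> real"
  assumes "e \<in> {1..L}" "0 \<le> w e" "w e \<le> 1"
  shows "measure_pmf.expectation (weights_pmf L w) f =
     w e * measure_pmf.expectation (Pi_pmf ({1..L} - {e}) False (\<lambda>e. bernoulli_pmf (w e)))
             (\<lambda>v. f (v(e := True)))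
   + (1 - w e) * measure_pmf.expectation (Pi_pmf ({1..L} - {e}) False (\<lambda>e. bernoulli_pmf (w e)))
             (\<lambda>v. f (v(e := False)))"
proof -
  let ?P = "Pi_pmf ({1..L} - {e}) False (\<lambda>e. bernoulli_pmf (w e))"
  have fin: "finite (set_pmf ?P)"
  proof -
    have "finite (PiE_dflt ({1..L} - {e}) False (\<lambda>_. UNIV :: bool set))"
      by (rule finite_PiE_dflt) auto
    moreover have "set_pmf ?P \<subseteq> PiE_dflt ({1..L} - {e}) False (\<lambda>_. UNIV)"
      by (auto simp: set_Pi_pmf PiE_dflt_def)
    ultimately show ?thesis by (rule rev_finite_subset)
  qed
  have "weights_pmf L w = Pi_pmf (insert e ({1..L} - {e})) False (\<lambda>e. bernoulli_pmf (w e))"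
    unfolding weights_pmf_def using assms(1) by (simp add: insert_absorb)
  also have "\<dots> = do {y \<leftarrow> bernoulli_pmf (w e); v \<leftarrow> ?P; return_pmf (v(e := y))}"
    by (subst Pi_pmf_insert') auto
  finally have "weights_pmf L w = do {y \<leftarrow> bernoulli_pmf (w e); v \<leftarrow> ?P; return_pmf (v(e := y))}" .
  then show ?thesis
    using assms fin by (simp add: expectation_bind_pmf_finite)
qed

section \<open>Changing one attraction probability in a single step\<close>

lemma Pi_pmf_bernoulli_upd:
  "Pi_pmf (S - {e}) False (\<lambda>e'. bernoulli_pmf (if e' = e then s else w e'))
    = Pi_pmf (S - {e}) False (\<lambda>e'. bernoulli_pmf (w e'))"
  by (rule Pi_pmf_cong) auto

lemma click_upd_notin: "e \<notin> set A \<Longrightarrow> click A (v(e := b)) = click A v"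
  unfolding click_def by (rule arg_cong[where f = Inf]) (auto simp: image_def nth_mem)

text \<open>The density of the Bernoulli law with mean \<open>s\<close> with respect to the one with
  mean \<open>q\<close>.\<close>

definition bernoulli_ratio :: "real \<Rightarrow> real \<Rightarrow> bool \<Rightarrow> real" where
  "bernoulli_ratio q s b = (if b then s / q else (1 - s) / (1 - q))"

text \<open>The finite branch of \<open>bernoulli_KL\<close> as a real function, so that the
  analysis stays in the reals until the final step.\<close>

definition real_bernoulli_KL :: "real \<Rightarrow> real \<Rightarrow> real" where
  "real_bernoulli_KL q s = q * ln (q / s) + (1 - q) * ln ((1 - q) / (1 - s))"

text \<open>If \<open>e\<close> is in the list, the density turns the mean \<open>w e\<close> into
  \<open>s\<close>; otherwise the click ignores the weight of \<open>e\<close> and no factor is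
  called for. The factor uses \<open>v e\<close> even when an earlier click hides it from the
  agent.\<close>

lemma expectation_click_upd:
  fixes f :: "enat \<Rightarrow> real"
  assumes "e \<in> {1..L}" "0 < w e" "w e < 1" "0 < s" "s < 1"
  shows "measure_pmf.expectation (weights_pmf L (w(e := s))) (\<lambda>v. f (click A v)) =
    measure_pmf.expectation (weights_pmf L w)
      (\<lambda>v. f (click A v) * (if e \<in> set A then bernoulli_ratio (w e) s (v e) else 1))"
  using assms
  by (subst (1 2) expectation_weights_pmf_split[where e = e]; cases "e \<in> set A")
    (simp_all add: Pi_pmf_bernoulli_upd click_upd_notin bernoulli_ratio_def flip: distrib_right)

lemma expectation_weights_pmf_coord:
  fixes f :: "bool \<Rightarrow> real"
  assumes "e \<in> {1..L}" "0 \<le> w e" "w e \<le> 1"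
  shows "measure_pmf.expectation (weights_pmf L w) (\<lambda>v. f (v e)) =
    w e * f True + (1 - w e) * f False"
  using assms by (subst expectation_weights_pmf_split[where e = e]) simp_all

text \<open>The items of a list are distinct and their weights independent, so the expectation of
  the product factorizes.\<close>

lemma expectation_reward:
  assumes A: "A \<in> klists L K" and w: "attraction_probs L w"
  shows "measure_pmf.expectation (weights_pmf L w) (\<lambda>v. reward A (\<lambda>e. of_bool (v e))) = reward A w"
proof -
  have d: "distinct A" "set A \<subseteq> {1..L}" using A by (auto simp: klists_def)
  \<comment> \<open>Padding with factors 1 turns the product over the list into one over the whole
    ground set, the form in which \<open>expectation_prod_Pi_pmf\<close> applies.\<close>
  have restrict: "(\<Prod>a\<leftarrow>A. g a) = (\<Prod>a\<in>{1..L}. if a \<in> set A then g a else 1)" for g :: "nat \<Rightarrow> real"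
  proof -
    have "(\<Prod>a\<leftarrow>A. g a) = (\<Prod>a\<in>set A. g a)"
      using d(1) by (simp add: prod.distinct_set_conv_list)
    also have "\<dots> = (\<Prod>a\<in>{1..L} \<inter> set A. g a)" using d(2) by (simp add: Int_absorb1)
    also have "\<dots> = (\<Prod>a\<in>{1..L}. if a \<in> set A then g a else 1)"
      by (rule prod.inter_restrict) simp
    finally show ?thesis .
  qed
  have "measure_pmf.expectation (weights_pmf L w) (\<lambda>v. \<Prod>a\<leftarrow>A. (1 - of_bool (v a) :: real)) =
    measure_pmf.expectation (weights_pmf L w)
      (\<lambda>v. \<Prod>a\<in>{1..L}. if a \<in> set A then 1 - of_bool (v a) else 1)"
    by (intro arg_cong[where f = "measure_pmf.expectation _"] ext restrict)
  also have "\<dots> = (\<Prod>a\<in>{1..L}. measure_pmf.expectation (bernoulli_pmf (w a))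
        (\<lambda>b. if a \<in> set A then 1 - of_bool b else 1))"
    unfolding weights_pmf_def
    by (rule expectation_prod_Pi_pmf) (auto intro: integrable_measure_pmf_finite)
  also have "\<dots> = (\<Prod>a\<in>{1..L}. if a \<in> set A then 1 - w a else 1)"
    using w by (intro prod.cong refl) (auto simp: attraction_probs_def)
  also have "\<dots> = (\<Prod>a\<leftarrow>A. 1 - w a)" by (rule restrict[symmetric])
  finally show ?thesis
    unfolding reward_def by (simp add: integrable_weights_pmf)
qed

section \<open>Trajectories\<close>

text \<open>The second component is polymorphic so that the count applies both to trajectories and
  to observed histories; the change of measure admits only functions of the latter.\<close>

definition item_pulls :: "nat \<Rightarrow> (nat list \<times> 'b) list \<Rightarrow> real" where
  "item_pulls e h = (\<Sum>A\<leftarrow>map fst h. of_bool (e \<in> set A))"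

lemma item_pulls_observe: "item_pulls e (observe h) = item_pulls e h"
  unfolding item_pulls_def observe_def by (simp add: case_prod_beta' comp_def)

lemma item_pulls_nonneg: "0 \<le> item_pulls e h"
  unfolding item_pulls_def by (induction h) auto

lemma item_pulls_le_length: "item_pulls e h \<le> length h"
  unfolding item_pulls_def by (induction h) auto

lemma length_minus_item_pulls:
  "length h - item_pulls e h = (\<Sum>A\<leftarrow>map fst h. of_bool (e \<notin> set A))"
  unfolding item_pulls_def by (induction h) auto

context
  fixes L K :: nat and \<pi> :: algorithm
  assumes valid: "valid_algorithm L K \<pi>"
begin

lemma finite_set_algorithm: "finite (set_pmf (\<pi> h))"
  using valid finite_klists finite_subset unfolding valid_algorithm_def by blast

lemma finite_set_trajectory: "finite (set_pmf (trajectory_pmf L w \<pi> n))"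
  by (induction n) (auto simp: finite_set_algorithm finite_set_weights_pmf)

lemma integrable_trajectory:
  "integrable (measure_pmf (trajectory_pmf L w \<pi> n)) (f :: _ \<Rightarrow> real)"
  by (rule integrable_measure_pmf_finite[OF finite_set_trajectory])

lemma integrable_algorithm: "integrable (measure_pmf (\<pi> h)) (f :: _ \<Rightarrow> real)"
  by (rule integrable_measure_pmf_finite[OF finite_set_algorithm])

lemma trajectory_length: "h \<in> set_pmf (trajectory_pmf L w \<pi> n) \<Longrightarrow> length h = n"
  by (induction n arbitrary: h) auto

lemma trajectory_lists:
  "h \<in> set_pmf (trajectory_pmf L w \<pi> n) \<Longrightarrow> set (map fst h) \<subseteq> klists L K"
proof (induction n arbitrary: h)
  case (Suc n)
  then obtain h' A v where "h' \<in> set_pmf (trajectory_pmf L w \<pi> n)"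
    "A \<in> set_pmf (\<pi> (observe h'))" "h = h' @ [(A, v)]"
    by auto
  with Suc.IH[of h'] valid show ?case unfolding valid_algorithm_def by auto
qed simp

lemma expectation_trajectory_Suc:
  fixes F :: "_ \<Rightarrow> real"
  shows "measure_pmf.expectation (trajectory_pmf L w \<pi> (Suc n)) F =
    measure_pmf.expectation (trajectory_pmf L w \<pi> n) (\<lambda>h.
      measure_pmf.expectation (\<pi> (observe h)) (\<lambda>A.
        measure_pmf.expectation (weights_pmf L w) (\<lambda>v. F (h @ [(A, v)]))))"
  by (simp add: expectation_bind_pmf_finite finite_set_algorithm finite_set_trajectory
      finite_set_weights_pmf)

text \<open>The weights of a step are independent of the past and of the list chosen in that step,
  so each summand may be averaged over them. This yields both the regret decomposition and a Wald
  identity for the log-likelihood.\<close>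

lemma expectation_trajectory_sum:
  fixes G :: "nat list \<Rightarrow> (nat \<Rightarrow> bool) \<Rightarrow> real"
  shows "measure_pmf.expectation (trajectory_pmf L w \<pi> n) (\<lambda>h. \<Sum>(A, v)\<leftarrow>h. G A v) =
    measure_pmf.expectation (trajectory_pmf L w \<pi> n)
      (\<lambda>h. \<Sum>A\<leftarrow>map fst h. measure_pmf.expectation (weights_pmf L w) (G A))"
proof (induction n)
  case (Suc n)
  then show ?case
    unfolding expectation_trajectory_Suc
    by (simp add: integrable_trajectory integrable_algorithm integrable_weights_pmf comp_def)
qed simp

text \<open>The algorithm is the same kernel on observations in both bandits, so only the weights
  contribute to the likelihood ratio, one factor per step that recommends \<open>e\<close>.\<close>

lemma expectation_trajectory_change_of_measure:
  fixes g :: "(nat list \<times> enat) list \<Rightarrow> real"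
  assumes "e \<in> {1..L}" "0 < w e" "w e < 1" "0 < s" "s < 1"
  shows "measure_pmf.expectation (trajectory_pmf L (w(e := s)) \<pi> n) (\<lambda>h. g (observe h)) =
    measure_pmf.expectation (trajectory_pmf L w \<pi> n) (\<lambda>h. g (observe h) *
      (\<Prod>(A, v)\<leftarrow>h. if e \<in> set A then bernoulli_ratio (w e) s (v e) else 1))"
proof (induction n arbitrary: g)
  case (Suc n)
  let ?r = "\<lambda>A v. if e \<in> set A then bernoulli_ratio (w e) s (v e) else 1"
  let ?LR = "\<lambda>h. \<Prod>(A, v)\<leftarrow>h. ?r A v"
  \<comment> \<open>Averaging out the last step of the modified bandit leaves a function of the
    shorter observation, to which the induction hypothesis applies; hence the induction over
    arbitrary \<open>g\<close>.\<close>
  define g' where "g' ob = measure_pmf.expectation (\<pi> ob) (\<lambda>A.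
     measure_pmf.expectation (weights_pmf L (w(e := s))) (\<lambda>v. g (ob @ [(A, click A v)])))" for ob
  have obs: "observe (h @ [(A, v)]) = observe h @ [(A, click A v)]" for h A v
    by (simp add: observe_def)
  have "measure_pmf.expectation (trajectory_pmf L (w(e := s)) \<pi> (Suc n)) (\<lambda>h. g (observe h)) =
     measure_pmf.expectation (trajectory_pmf L (w(e := s)) \<pi> n) (\<lambda>h. g' (observe h))"
    unfolding expectation_trajectory_Suc g'_def obs ..
  also have "\<dots> = measure_pmf.expectation (trajectory_pmf L w \<pi> n) (\<lambda>h. g' (observe h) * ?LR h)"
    by (rule Suc.IH)
  also have "\<dots> = measure_pmf.expectation (trajectory_pmf L w \<pi> (Suc n)) (\<lambda>h. g (observe h) * ?LR h)"
  proof -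
    have "g' (observe h) * ?LR h = measure_pmf.expectation (\<pi> (observe h)) (\<lambda>A.
        measure_pmf.expectation (weights_pmf L w)
          (\<lambda>v. g (observe h @ [(A, click A v)]) * (?LR h * ?r A v)))" for h
    proof -
      have "measure_pmf.expectation (weights_pmf L w)
          (\<lambda>v. g (observe h @ [(A, click A v)]) * (?LR h * ?r A v)) =
        measure_pmf.expectation (weights_pmf L (w(e := s)))
          (\<lambda>v. g (observe h @ [(A, click A v)])) * ?LR h" for A
        unfolding expectation_click_upd[where f = "\<lambda>c. g (observe h @ [(A, c)])" and e = e
          and w = w, OF assms]
        by (subst integral_mult_left_zero[symmetric]) (simp add: ac_simps)
      then show ?thesis unfolding g'_def by simp
    qed
    then show ?thesis unfolding expectation_trajectory_Suc obs by simp
  qed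
  finally show ?case .
qed (simp add: observe_def)

section \<open>Information gained from recommending one item\<close>

definition expected_item_pulls :: "(nat \<Rightarrow> real) \<Rightarrow> nat \<Rightarrow> nat \<Rightarrow> real" where
  "expected_item_pulls w e n = measure_pmf.expectation (trajectory_pmf L w \<pi> n) (item_pulls e)"

text \<open>Wald's identity: every step that recommends \<open>e\<close> adds
  \<open>- real_bernoulli_KL (w e) s\<close> in the mean, and all other steps add 0.\<close>

lemma expectation_log_likelihood:
  assumes "e \<in> {1..L}" "0 < w e" "w e < 1" "0 < s" "s < 1"
  shows "measure_pmf.expectation (trajectory_pmf L w \<pi> n)
      (\<lambda>h. \<Sum>(A, v)\<leftarrow>h. if e \<in> set A then ln (bernoulli_ratio (w e) s (v e)) else 0) =
    - expected_item_pulls w e n * real_bernoulli_KL (w e) s"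
proof -
  have step: "measure_pmf.expectation (weights_pmf L w)
      (\<lambda>v. if e \<in> set A then ln (bernoulli_ratio (w e) s (v e)) else 0) =
    of_bool (e \<in> set A) * - real_bernoulli_KL (w e) s" for A
  proof (cases "e \<in> set A")
    case True
    have "measure_pmf.expectation (weights_pmf L w) (\<lambda>v. ln (bernoulli_ratio (w e) s (v e))) =
        w e * ln (s / w e) + (1 - w e) * ln ((1 - s) / (1 - w e))"
      using assms expectation_weights_pmf_coord[where f = "\<lambda>b. ln (bernoulli_ratio (w e) s b)"]
      by (simp add: bernoulli_ratio_def)
    with True assms show ?thesis
      by (simp add: real_bernoulli_KL_def ln_div algebra_simps)
  qed simp
  then show ?thesis
    unfolding expectation_trajectory_sum expected_item_pulls_def item_pulls_def step
      sum_list_mult_const by simp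
qed

text \<open>A change of measure with the test function \<open>exp (c Y)\<close>, where \<open>Y\<close> is the fraction of steps
  missing \<open>e\<close>: the hypothesis on \<open>c\<close> says that its mean in the modified bandit is at most 2. Applying
  \<open>1 + x \<le> exp x\<close> to the logarithm of the integrand replaces the usual data processing inequality.\<close>

lemma item_pulls_information_inequality:
  assumes e: "e \<in> {1..L}" "0 < w e" "w e < 1" "0 < s" "s < 1"
    and n: "0 < n"
    and c: "(n - expected_item_pulls (w(e := s)) e n) * (exp c - 1) \<le> n"
  shows "c * (1 - expected_item_pulls w e n / n) - ln 2
    \<le> expected_item_pulls w e n * real_bernoulli_KL (w e) s"
proof -
  let ?E = "measure_pmf.expectation (trajectory_pmf L w \<pi> n)"
  let ?E' = "measure_pmf.expectation (trajectory_pmf L (w(e := s)) \<pi> n)"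
  let ?Y = "\<lambda>h. 1 - item_pulls e h / n"
  let ?\<Lambda> = "\<lambda>h. \<Sum>(A, v)\<leftarrow>h. if e \<in> set A then ln (bernoulli_ratio (w e) s (v e)) else 0"
  let ?LR = "\<lambda>h. \<Prod>(A, v)\<leftarrow>h. if e \<in> set A then bernoulli_ratio (w e) s (v e) else 1"
  have pos: "0 < bernoulli_ratio (w e) s b" for b
    using e by (simp add: bernoulli_ratio_def)
  have LR: "exp (?\<Lambda> h) = ?LR h" for h :: "(nat list \<times> (nat \<Rightarrow> bool)) list"
  proof (induction h)
    case (Cons x h)
    then show ?case by (cases x) (auto simp: exp_add pos)
  qed simp
  \<comment> \<open>Subtracting \<open>ln 2\<close> divides the test function by the bound 2 on its
    mean, so the right side will be at most 1 and cancel the leading 1 on the left.\<close>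
  have "?E (\<lambda>h. 1 + (c * ?Y h - ln 2 + ?\<Lambda> h)) \<le> ?E (\<lambda>h. exp (c * ?Y h) / 2 * ?LR h)"
  proof (rule expectation_mono_finite[OF finite_set_trajectory])
    fix h :: "(nat list \<times> (nat \<Rightarrow> bool)) list"
    have "1 + (c * ?Y h - ln 2 + ?\<Lambda> h) \<le> exp (c * ?Y h - ln 2 + ?\<Lambda> h)"
      by (rule exp_ge_add_one_self)
    also have "\<dots> = exp (c * ?Y h) / 2 * ?LR h"
      by (simp only: exp_add exp_diff LR) simp
    finally show "1 + (c * ?Y h - ln 2 + ?\<Lambda> h) \<le> exp (c * ?Y h) / 2 * ?LR h" .
  qed
  also have "\<dots> = ?E' (\<lambda>h. exp (c * ?Y h) / 2)"
    using expectation_trajectory_change_of_measure[where n = n and w = w and s = s and e = e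
        and g = "\<lambda>ob. exp (c * (1 - item_pulls e ob / n)) / 2", OF e]
    by (simp only: item_pulls_observe)
  also have "\<dots> \<le> ?E' (\<lambda>h. (1 + ?Y h * (exp c - 1)) / 2)"
  proof (rule expectation_mono_finite[OF finite_set_trajectory])
    fix h assume h: "h \<in> set_pmf (trajectory_pmf L (w(e := s)) \<pi> n)"
    \<comment> \<open>The chord of the convex exponential between 0 and \<open>c\<close>. It is
      linear in \<open>y\<close>, so only the mean fraction of misses enters, which is what
      consistency controls.\<close>
    have chord: "exp (c * y) \<le> 1 + y * (exp c - 1)" if "0 \<le> y" "y \<le> 1" for y
      using convex_onD[OF exp_convex that, of 0 c] by (simp add: algebra_simps)
    have "0 \<le> ?Y h" "?Y h \<le> 1"
      using n item_pulls_le_length[of e h] trajectory_length[OF h] item_pulls_nonneg[of e h]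
      by (auto simp: field_simps)
    then show "exp (c * ?Y h) / 2 \<le> (1 + ?Y h * (exp c - 1)) / 2"
      by (intro divide_right_mono chord) auto
  qed
  also have "\<dots> = (1 + (1 - expected_item_pulls (w(e := s)) e n / n) * (exp c - 1)) / 2"
    unfolding expected_item_pulls_def by (simp add: integrable_trajectory)
  also have "\<dots> \<le> 1"
    using c n by (simp add: field_simps)
  finally have "?E (\<lambda>h. 1 + (c * ?Y h - ln 2 + ?\<Lambda> h)) \<le> 1" .
  moreover have "?E (\<lambda>h. 1 + (c * ?Y h - ln 2 + ?\<Lambda> h)) =
    1 + (c * (1 - expected_item_pulls w e n / n) - ln 2 + ?E ?\<Lambda>)"
    unfolding expected_item_pulls_def
    by (simp add: integrable_trajectory right_diff_distrib)
  ultimately show ?thesis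
    unfolding expectation_log_likelihood[where w = w and e = e and s = s, OF e] by linarith
qed

section \<open>Consequences of consistency, and the regret as a sum of gaps\<close>

lemma consistent_smallo:
  assumes "consistent L K \<pi>" "attraction_probs L w" "\<alpha> > 0"
    and "\<And>A. A \<in> klists L K \<Longrightarrow> P A \<Longrightarrow> suboptimal_list L K w A"
  shows "(\<lambda>n. measure_pmf.expectation (trajectory_pmf L w \<pi> n)
     (\<lambda>h. \<Sum>A\<leftarrow>map fst h. of_bool (P A))) \<in> o(\<lambda>n. real n powr \<alpha>)"
proof -
  \<comment> \<open>There are only finitely many lists, so the count splits into finitely many pull
    counts of suboptimal lists, each of which consistency bounds.\<close>
  have count: "(\<Sum>A\<leftarrow>xs. of_bool (P A)) = (\<Sum>A\<in>{A \<in> klists L K. P A}. real (count_list xs A))"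
    if "set xs \<subseteq> klists L K" for xs
    using that
  proof (induction xs)
    case (Cons A xs)
    have "real (count_list (A # xs) B) = (if B = A then 1 else 0) + real (count_list xs B)" for B
      by simp
    with Cons show ?case
      by (simp add: sum.distrib finite_klists del: count_list.simps)
  qed simp
  have "measure_pmf.expectation (trajectory_pmf L w \<pi> n) (\<lambda>h. \<Sum>A\<leftarrow>map fst h. of_bool (P A)) =
      (\<Sum>A\<in>{A \<in> klists L K. P A}. expected_pulls L w \<pi> A n)" for n
  proof -
    have "measure_pmf.expectation (trajectory_pmf L w \<pi> n) (\<lambda>h. \<Sum>A\<leftarrow>map fst h. of_bool (P A)) =
      measure_pmf.expectation (trajectory_pmf L w \<pi> n)
        (\<lambda>h. \<Sum>A\<in>{A \<in> klists L K. P A}. real (count_list (map fst h) A))"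
      by (intro expectation_cong count trajectory_lists)
    then show ?thesis
      unfolding expected_pulls_def by (simp add: integrable_trajectory)
  qed
  moreover have "(\<lambda>n. \<Sum>A\<in>{A \<in> klists L K. P A}. expected_pulls L w \<pi> A n)
      \<in> o(\<lambda>n. real n powr \<alpha>)"
    using assms unfolding consistent_def by (intro big_sum_in_smallo) auto
  ultimately show ?thesis by simp
qed

lemma expected_item_pulls_smallo:
  assumes "consistent L K \<pi>" "attraction_probs L w" "\<alpha> > 0"
    and "\<And>A. A \<in> klists L K \<Longrightarrow> e \<in> set A \<Longrightarrow> suboptimal_list L K w A"
  shows "expected_item_pulls w e \<in> o(\<lambda>n. real n powr \<alpha>)"
  using consistent_smallo[where P = "\<lambda>A. e \<in> set A", OF assms]
  by (simp add: expected_item_pulls_def[abs_def] item_pulls_def[abs_def])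

lemma expected_item_misses_smallo:
  assumes "consistent L K \<pi>" "attraction_probs L w" "\<alpha> > 0"
    and "\<And>A. A \<in> klists L K \<Longrightarrow> e \<notin> set A \<Longrightarrow> suboptimal_list L K w A"
  shows "(\<lambda>n. n - expected_item_pulls w e n) \<in> o(\<lambda>n. real n powr \<alpha>)"
proof -
  have "n - expected_item_pulls w e n = measure_pmf.expectation (trajectory_pmf L w \<pi> n)
      (\<lambda>h. \<Sum>A\<leftarrow>map fst h. of_bool (e \<notin> set A))" for n
  proof -
    have "n - expected_item_pulls w e n =
        measure_pmf.expectation (trajectory_pmf L w \<pi> n) (\<lambda>h. n - item_pulls e h)"
      by (simp add: expected_item_pulls_def integrable_trajectory)
    also have "\<dots> = measure_pmf.expectation (trajectory_pmf L w \<pi> n)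
      (\<lambda>h. \<Sum>A\<leftarrow>map fst h. of_bool (e \<notin> set A))"
      by (intro expectation_cong) (metis length_minus_item_pulls trajectory_length)
    finally show ?thesis .
  qed
  then show ?thesis
    using consistent_smallo[where P = "\<lambda>A. e \<notin> set A", OF assms] by simp
qed

text \<open>The regret is defined through realized weights; averaging over the weights of each step
  leaves the gap in mean reward of the recommended list.\<close>

lemma expected_regret_eq:
  assumes "attraction_probs L w" "Astar \<in> klists L K"
  shows "expected_regret L w \<pi> Astar n =
    measure_pmf.expectation (trajectory_pmf L w \<pi> n)
      (\<lambda>h. \<Sum>A\<leftarrow>map fst h. reward Astar w - reward A w)"
proof -
  have "expected_regret L w \<pi> Astar n = measure_pmf.expectation (trajectory_pmf L w \<pi> n)
      (\<lambda>h. \<Sum>A\<leftarrow>map fst h. measure_pmf.expectation (weights_pmf L w)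
        (\<lambda>v. instant_regret Astar A (\<lambda>e. of_bool (v e))))"
    unfolding expected_regret_def by (rule expectation_trajectory_sum)
  also have "\<dots> = measure_pmf.expectation (trajectory_pmf L w \<pi> n)
      (\<lambda>h. \<Sum>A\<leftarrow>map fst h. reward Astar w - reward A w)"
  proof (intro expectation_cong arg_cong[where f = sum_list] map_cong refl)
    fix h A assume "h \<in> set_pmf (trajectory_pmf L w \<pi> n)" "A \<in> set (map fst h)"
    then have "A \<in> klists L K" using trajectory_lists by blast
    with assms show "measure_pmf.expectation (weights_pmf L w)
        (\<lambda>v. instant_regret Astar A (\<lambda>e. of_bool (v e))) = reward Astar w - reward A w"
      unfolding instant_regret_def by (simp add: integrable_weights_pmf expectation_reward)
  qed
  finally show ?thesis .
qed

end

section \<open>Optimal lists\<close>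

lemma optimal_list_exists:
  assumes "K \<le> L"
  shows "\<exists>A. optimal_list L K w A"
proof -
  have "finite ((\<lambda>B. reward B w) ` klists L K)" "(\<lambda>B. reward B w) ` klists L K \<noteq> {}"
    using finite_klists klists_nonempty[OF assms] by auto
  from Max_in[OF this] obtain A where A: "A \<in> klists L K"
    "reward A w = Max ((\<lambda>B. reward B w) ` klists L K)" by auto
  have "reward B w \<le> reward A w" if "B \<in> klists L K" for B
    using that A(2) by (simp add: finite_klists)
  with A(1) show ?thesis
    unfolding optimal_list_def is_arg_max_linorder by blast
qed

lemma suboptimal_listI:
  assumes "K \<le> L" "A \<in> klists L K" "B \<in> klists L K" "reward A w < reward B w"
  shows "suboptimal_list L K w A"
proof -
  obtain Astar where "optimal_list L K w Astar" using optimal_list_exists[OF assms(1)] by blast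
  moreover from this assms have "reward A w < reward Astar w"
    unfolding optimal_list_def is_arg_max_linorder by (meson less_le_trans)
  ultimately show ?thesis using assms unfolding suboptimal_list_def by blast
qed

text \<open>Exchanging the first item of the list for \<open>e\<close> improves it strictly.\<close>

lemma suboptimal_without_best_item:
  assumes "1 \<le> K" "K \<le> L" "A \<in> klists L K" "e \<in> {1..L}" "e \<notin> set A"
    and "\<And>a. a \<in> set A \<Longrightarrow> w a < w e" and "w e \<le> 1"
  shows "suboptimal_list L K w A"
proof -
  obtain a as where A: "A = a # as" using assms by (cases A) (auto simp: klists_def)
  \<comment> \<open>No other item attracts with certainty, since \<open>w x < w e \<le> 1\<close>;
    this positivity is what makes the exchange strict.\<close>
  have "0 < (\<Prod>x\<leftarrow>as. 1 - w x)"
    using assms(6,7) unfolding A by (induction as) force+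
  then have "(1 - w e) * (\<Prod>x\<leftarrow>as. 1 - w x) < (1 - w a) * (\<Prod>x\<leftarrow>as. 1 - w x)"
    using assms(6)[of a] A by (intro mult_strict_right_mono) auto
  then have "reward A w < reward (e # as) w" by (simp add: A reward_def)
  moreover have "e # as \<in> klists L K" using assms(3-5) by (auto simp: A klists_def)
  ultimately show ?thesis using assms by (intro suboptimal_listI)
qed

text \<open>Each factor is \<open>1 - p\<close> or \<open>1 - p + \<Delta>\<close>. Expanding in
  \<Delta>, the terms of order at least two are nonnegative and are dropped.\<close>

lemma prod_list_LB_probs_ge:
  assumes "p \<le> 1" "0 \<le> \<Delta>"
  shows "(1 - p) ^ length A + \<Delta> * (1 - p) ^ (length A - 1) * (\<Sum>a\<leftarrow>A. of_bool (K < a))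
    \<le> (\<Prod>a\<leftarrow>A. 1 - LB_probs K p \<Delta> a)"
proof (induction A)
  case (Cons a A)
  let ?x = "1 - p" and ?M = "\<Sum>a\<leftarrow>A. of_bool (K < a) :: real"
  let ?Q = "\<Prod>a\<leftarrow>A. 1 - LB_probs K p \<Delta> a"
  have x: "0 \<le> ?x" using assms by simp
  have M: "0 \<le> ?M" by (rule sum_list_nonneg) auto
  \<comment> \<open>For empty \<open>A\<close> the subtraction in the exponent truncates, but then
    \<open>?M\<close> is 0 and both sides vanish.\<close>
  have shift: "?x * (\<Delta> * ?x ^ (length A - 1) * ?M) = \<Delta> * ?x ^ length A * ?M"
    by (cases A) auto
  have "?x * (?x ^ length A + \<Delta> * ?x ^ (length A - 1) * ?M) \<le> ?x * ?Q"
    using Cons x by (rule mult_left_mono)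
  then have 1: "?x ^ Suc (length A) + \<Delta> * ?x ^ length A * ?M \<le> ?x * ?Q"
    by (simp only: distrib_left shift power_Suc)
  have "?x ^ length A \<le> ?x ^ length A + \<Delta> * ?x ^ (length A - 1) * ?M"
    using x M assms by simp
  with Cons have "?x ^ length A \<le> ?Q" by linarith
  then have 2: "\<Delta> * ?x ^ length A \<le> \<Delta> * ?Q" using assms by (intro mult_left_mono)
  show ?case
    using 1 2 by (simp add: LB_probs_def algebra_simps)
qed simp

text \<open>By distinctness both sides count the suboptimal items in \<open>A\<close>. The
  right-hand form lets the regret be split by item.\<close>

lemma sum_item_indicators:
  assumes "A \<in> klists L K"
  shows "(\<Sum>a\<leftarrow>A. of_bool (K < a)) = (\<Sum>e\<in>{K<..L}. of_bool (e \<in> set A) :: real)"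
proof -
  have "distinct A" "set A \<subseteq> {1..L}" using assms by (auto simp: klists_def)
  then have "(\<Sum>a\<leftarrow>A. of_bool (K < a)) = (\<Sum>a\<in>set A. of_bool (K < a) :: real)"
    by (intro sum.distinct_set_conv_list[symmetric])
  also have "\<dots> = real (card (set A \<inter> {K<..L}))"
    using \<open>set A \<subseteq> {1..L}\<close> by (subst sum_of_bool_eq) (auto intro!: arg_cong[where f = card])
  also have "\<dots> = (\<Sum>e\<in>{K<..L}. of_bool (e \<in> set A))"
    by (subst sum_of_bool_eq) (auto intro!: arg_cong[where f = card])
  finally show ?thesis .
qed

text \<open>The optimal reward is at least \<open>1 - (1 - p) ^ K\<close>, the reward of the first
  \<open>K\<close> items; this cancels the leading term of
  \<open>prod_list_LB_probs_ge\<close>.\<close>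

lemma LB_regret_ge:
  assumes "K \<le> L" "p \<le> 1" "0 \<le> \<Delta>" "A \<in> klists L K"
    and "optimal_list L K (LB_probs K p \<Delta>) Astar"
  shows "\<Delta> * (1 - p) ^ (K - 1) * (\<Sum>e\<in>{K<..L}. of_bool (e \<in> set A))
    \<le> reward Astar (LB_probs K p \<Delta>) - reward A (LB_probs K p \<Delta>)"
proof -
  have "map (\<lambda>a. 1 - LB_probs K p \<Delta> a) [1..<Suc K] = replicate K (1 - p)"
    by (rule nth_equalityI) (auto simp: LB_probs_def simp del: upt_Suc)
  then have "reward [1..<Suc K] (LB_probs K p \<Delta>) = 1 - (1 - p) ^ K"
    unfolding reward_def by (simp only: prod_list_replicate)
  moreover have "reward [1..<Suc K] (LB_probs K p \<Delta>) \<le> reward Astar (LB_probs K p \<Delta>)"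
    using assms(5) klists_nonempty[OF assms(1)]
    unfolding optimal_list_def is_arg_max_linorder by blast
  moreover have "length A = K" using assms(4) by (simp add: klists_def)
  ultimately show ?thesis
    using prod_list_LB_probs_ge[OF assms(2,3), of A K]
    unfolding sum_item_indicators[OF assms(4)] by (simp add: reward_def)
qed

lemma LB_suboptimal:
  assumes "K \<le> L" "p < 1" "0 < \<Delta>" "A \<in> klists L K" "e \<in> set A" "K < e"
    and opt: "optimal_list L K (LB_probs K p \<Delta>) Astar"
  shows "suboptimal_list L K (LB_probs K p \<Delta>) A"
proof -
  have "e \<le> L" using assms by (auto simp: klists_def)
  then have "(1::real) \<le> (\<Sum>e\<in>{K<..L}. of_bool (e \<in> set A))"
    using assms member_le_sum[of e "{K<..L}" "\<lambda>e. of_bool (e \<in> set A) :: real"] by auto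
  then have "0 < \<Delta> * (1 - p) ^ (K - 1) * (\<Sum>e\<in>{K<..L}. of_bool (e \<in> set A))"
    using assms by (intro mult_pos_pos) auto
  also have "\<dots> \<le> reward Astar (LB_probs K p \<Delta>) - reward A (LB_probs K p \<Delta>)"
    using assms by (intro LB_regret_ge) auto
  finally show ?thesis
    using assms unfolding suboptimal_list_def by auto
qed

lemma LB_attraction_probs:
  "0 \<le> p - \<Delta> \<Longrightarrow> 0 \<le> \<Delta> \<Longrightarrow> p \<le> 1 \<Longrightarrow> attraction_probs L (LB_probs K p \<Delta>)"
  by (auto simp: attraction_probs_def LB_probs_def)

lemma expected_regret_LB_ge:
  assumes "valid_algorithm L K \<pi>" "K \<le> L" "p \<le> 1" "0 < \<Delta>" "\<Delta> < p"
    and "optimal_list L K (LB_probs K p \<Delta>) Astar"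
  shows "\<Delta> * (1 - p) ^ (K - 1) * (\<Sum>e\<in>{K<..L}. expected_item_pulls L \<pi> (LB_probs K p \<Delta>) e n)
    \<le> expected_regret L (LB_probs K p \<Delta>) \<pi> Astar n"
proof -
  let ?w = "LB_probs K p \<Delta>"
  let ?E = "measure_pmf.expectation (trajectory_pmf L ?w \<pi> n)"
  have Astar: "Astar \<in> klists L K"
    using assms(6) unfolding optimal_list_def is_arg_max_linorder by blast
  have "\<Delta> * (1 - p) ^ (K - 1) * (\<Sum>e\<in>{K<..L}. expected_item_pulls L \<pi> ?w e n) =
    ?E (\<lambda>h. \<Delta> * (1 - p) ^ (K - 1) * (\<Sum>e\<in>{K<..L}. item_pulls e h))"
    using assms(1) by (simp add: expected_item_pulls_def integrable_trajectory)
  also have "\<dots> \<le> ?E (\<lambda>h. \<Sum>A\<leftarrow>map fst h. reward Astar ?w - reward A ?w)"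
  proof (rule expectation_mono_finite[OF finite_set_trajectory[OF assms(1)]])
    fix h assume "h \<in> set_pmf (trajectory_pmf L ?w \<pi> n)"
    then have "set (map fst h) \<subseteq> klists L K" by (rule trajectory_lists[OF assms(1)])
    then have "(\<Sum>A\<leftarrow>map fst h. \<Delta> * (1 - p) ^ (K - 1) * (\<Sum>e\<in>{K<..L}. of_bool (e \<in> set A)))
      \<le> (\<Sum>A\<leftarrow>map fst h. reward Astar ?w - reward A ?w)"
      using assms by (intro sum_list_mono LB_regret_ge) auto
    moreover have "(\<Sum>A\<leftarrow>xs. \<Delta> * (1 - p) ^ (K - 1) * (\<Sum>e\<in>{K<..L}. of_bool (e \<in> set A)))
      = \<Delta> * (1 - p) ^ (K - 1) * (\<Sum>e\<in>{K<..L}. \<Sum>A\<leftarrow>xs. of_bool (e \<in> set A))" for xs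
      by (induction xs) (simp_all add: sum.distrib distrib_left)
    ultimately show "\<Delta> * (1 - p) ^ (K - 1) * (\<Sum>e\<in>{K<..L}. item_pulls e h)
      \<le> (\<Sum>A\<leftarrow>map fst h. reward Astar ?w - reward A ?w)"
      by (simp only: item_pulls_def)
  qed
  also have "\<dots> = expected_regret L ?w \<pi> Astar n"
    using assms Astar by (intro expected_regret_eq[symmetric] LB_attraction_probs) auto
  finally show ?thesis .
qed

section \<open>Asymptotics\<close>

text \<open>Gibbs' inequality: \<open>ln x < x - 1\<close> for \<open>x \<noteq> 1\<close> is
  applied to both density values, and the weighted linear bounds sum to 0.\<close>

lemma real_bernoulli_KL_pos:
  assumes "0 < q" "q < 1" "0 < s" "s < 1" "q \<noteq> s"
  shows "0 < real_bernoulli_KL q s"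
proof -
  have ln: "- ln x > 1 - x" if "x > 0" "x \<noteq> 1" for x :: real
    using ln_le_minus_one[of x] ln_eq_minus_one[of x] that by linarith
  have "1 - s / q < - ln (s / q)" "1 - (1 - s) / (1 - q) < - ln ((1 - s) / (1 - q))"
    using assms by (intro ln; simp)+
  then have "q * (1 - s / q) < q * ln (q / s)"
    "(1 - q) * (1 - (1 - s) / (1 - q)) < (1 - q) * ln ((1 - q) / (1 - s))"
    using assms by (auto simp: ln_div)
  moreover have "q * (1 - s / q) + (1 - q) * (1 - (1 - s) / (1 - q)) = 0"
    using assms by (simp add: field_simps)
  ultimately show ?thesis unfolding real_bernoulli_KL_def by linarith
qed

lemma isCont_real_bernoulli_KL:
  assumes "0 < q" "q < 1" "0 < s" "s < 1"
  shows "isCont (real_bernoulli_KL q) s"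
  unfolding real_bernoulli_KL_def[abs_def] using assms by (intro continuous_intros) auto

lemma expected_item_pulls_ge_log:
  assumes valid: "valid_algorithm L K \<pi>" and cons: "consistent L K \<pi>"
    and L: "1 \<le> K" "K \<le> L" "e \<in> {1..L}"
    and w: "attraction_probs L w" "0 < w e" "\<And>a. a \<in> {1..L} \<Longrightarrow> w a \<le> p" "w e < p" "p < 1"
    and sub: "\<And>A. A \<in> klists L K \<Longrightarrow> e \<in> set A \<Longrightarrow> suboptimal_list L K w A"
    and \<eta>: "0 < \<eta>" "\<eta> * real_bernoulli_KL (w e) p < 1"
  shows "eventually (\<lambda>n. \<eta> * ln n \<le> expected_item_pulls L \<pi> w e n) sequentially"
proof -
  have p: "0 < p" using w by simp
  have we: "w e < 1" using w by simp
  \<comment> \<open>By continuity in \<open>s\<close>, the strict inequality for \<eta> survives for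
    some \<open>s\<close> slightly above \<open>p\<close>; \<open>s > p\<close> makes
    \<open>e\<close> the unique best item of the modified bandit.\<close>
  have "eventually (\<lambda>s. \<eta> * real_bernoulli_KL (w e) s < 1) (at_right p)"
  proof (rule order_tendstoD(2)[OF _ \<eta>(2)])
    show "((\<lambda>s. \<eta> * real_bernoulli_KL (w e) s) \<longlongrightarrow> \<eta> * real_bernoulli_KL (w e) p) (at_right p)"
      using isCont_real_bernoulli_KL[OF w(2) we p w(5)]
      by (intro tendsto_intros) (auto simp: isCont_def intro: tendsto_within_subset)
  qed
  moreover have "eventually (\<lambda>s. p < s \<and> s < 1) (at_right p)"
    using w(5) by (auto simp: eventually_at_right_field)
  ultimately have "eventually (\<lambda>s. \<eta> * real_bernoulli_KL (w e) s < 1 \<and> p < s \<and> s < 1) (at_right p)"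
    by eventually_elim auto
  then obtain s where s: "\<eta> * real_bernoulli_KL (w e) s < 1" "p < s" "s < 1"
    using eventually_happens trivial_limit_at_right_real by blast
  let ?D = "real_bernoulli_KL (w e) s"
  have D: "0 < ?D" using w p we s by (intro real_bernoulli_KL_pos) auto
  \<comment> \<open>Chosen so that \<open>\<eta> * ?D + \<epsilon> = 1 - 2 * \<epsilon> \<le> (1 -
    \<epsilon>)^2\<close>; the spare \<open>\<epsilon> * ln n\<close> absorbs the term
    \<open>ln 2\<close>.\<close>
  define \<epsilon> where "\<epsilon> = (1 - \<eta> * ?D) / 3"
  have \<eta>D: "\<eta> * ?D = 1 - 3 * \<epsilon>" by (simp add: \<epsilon>_def field_simps)
  have \<epsilon>: "0 < \<epsilon>" "\<epsilon> < 1" using s(1) mult_pos_pos[OF \<eta>(1) D] by (auto simp: \<epsilon>_def)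
  have w': "attraction_probs L (w(e := s))"
    using w(1) s p by (auto simp: attraction_probs_def)
  have sub': "suboptimal_list L K (w(e := s)) A" if "A \<in> klists L K" "e \<notin> set A" for A
  proof (rule suboptimal_without_best_item[OF L(1,2) that(1) L(3) that(2)])
    fix a assume "a \<in> set A"
    with that have "a \<in> {1..L}" "a \<noteq> e" by (auto simp: klists_def)
    with w(3)[of a] s show "(w(e := s)) a < (w(e := s)) e" by auto
  qed (use s in auto)
  have "eventually (\<lambda>n. norm (expected_item_pulls L \<pi> w e n) \<le> \<epsilon> * norm (real n powr 1)) sequentially"
    by (rule landau_o.smallD[OF expected_item_pulls_smallo[OF valid cons w(1) _ sub]])
      (use \<epsilon> in auto)
  moreover have "eventually (\<lambda>n. norm (real n - expected_item_pulls L \<pi> (w(e := s)) e n)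
      \<le> 1 * norm (real n powr \<epsilon>)) sequentially"
    by (rule landau_o.smallD[OF expected_item_misses_smallo[OF valid cons w' _ sub']])
      (use \<epsilon> in auto)
  moreover have "eventually (\<lambda>n. ln 2 \<le> \<epsilon> * ln (real n)) sequentially"
    using \<epsilon> by real_asymp
  moreover have "eventually (\<lambda>n. 1 \<le> n) sequentially" by (rule eventually_ge_at_top)
  ultimately show ?thesis
  proof eventually_elim
    case (elim n)
    let ?T = "expected_item_pulls L \<pi> w e n"
    have n: "1 \<le> real n" using elim by simp
    have ln: "0 \<le> ln (real n)" using n by simp
    \<comment> \<open>With this choice \<open>exp ?c\<close> is
      \<open>n powr (1 - \<epsilon>)\<close>, so its product with the at most
      \<open>n powr \<epsilon>\<close> expected misses stays below \<open>n\<close>, as the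
      information inequality demands.\<close>
    let ?c = "(1 - \<epsilon>) * ln n"
    have exp_c: "exp ?c = n powr (1 - \<epsilon>)" using n by (simp add: powr_def)
    have c0: "1 \<le> exp ?c" using \<epsilon> ln by simp
    have "(n - expected_item_pulls L \<pi> (w(e := s)) e n) * (exp ?c - 1) \<le> n powr \<epsilon> * (exp ?c - 1)"
      using elim c0 by (intro mult_right_mono) auto
    also have "\<dots> \<le> n powr \<epsilon> * n powr (1 - \<epsilon>)"
      unfolding exp_c by (intro mult_left_mono) auto
    also have "\<dots> = n" using n by (simp flip: powr_add)
    finally have "?c * (1 - ?T / n) - ln 2 \<le> ?T * ?D"
      using w we s p L elim by (intro item_pulls_information_inequality[OF valid]) auto
    moreover have "1 - \<epsilon> \<le> 1 - ?T / n"
      using elim n by (auto simp: field_simps)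
    then have "?c * (1 - \<epsilon>) \<le> ?c * (1 - ?T / n)"
      using \<epsilon> ln by (intro mult_left_mono) auto
    moreover have "\<eta> * ?D * ln n + \<epsilon> * ln n \<le> ?c * (1 - \<epsilon>)"
    proof -
      have "(\<eta> * ?D + \<epsilon>) \<le> (1 - \<epsilon>) * (1 - \<epsilon>)"
        using \<open>0 < \<epsilon>\<close> by (simp add: \<eta>D algebra_simps)
      from mult_right_mono[OF this ln] show ?thesis by (simp add: algebra_simps)
    qed
    ultimately have "\<eta> * ln n * ?D \<le> ?T * ?D" using elim by (simp add: algebra_simps)
    then show "\<eta> * ln n \<le> ?T" using D by simp
  qed
qed

theorem theorem4:
  fixes L K :: nat and p \<Delta> :: real and \<pi> :: algorithm and Astar :: "nat list"
  assumes "1 \<le> K" and "K \<le> L"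
    and "0 < p" and "p \<le> 1"
    and "0 < \<Delta>" and "\<Delta> < p"
    and "valid_algorithm L K \<pi>"
    and "consistent L K \<pi>"
    and "optimal_list L K (LB_probs K p \<Delta>) Astar"
  shows "liminf (\<lambda>n. ereal (expected_regret L (LB_probs K p \<Delta>) \<pi> Astar n / ln (real n)))
    \<ge> ereal ((real L - real K) * \<Delta> * (1 - p) ^ (K - 1)) / bernoulli_KL (p - \<Delta>) p"
proof -
  let ?w = "LB_probs K p \<Delta>"
  let ?R = "expected_regret L ?w \<pi> Astar"
  let ?C = "(real L - real K) * \<Delta> * (1 - p) ^ (K - 1)"
  have liminf_ge: "ereal (?C * \<eta>) \<le> liminf (\<lambda>n. ereal (?R n / ln n))"
    if "\<And>e. e \<in> {K<..L} \<Longrightarrow>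
      eventually (\<lambda>n. \<eta> * ln n \<le> expected_item_pulls L \<pi> ?w e n) sequentially" for \<eta>
  proof (rule Liminf_bounded)
    have "eventually (\<lambda>n. \<forall>e\<in>{K<..L}. \<eta> * ln n \<le> expected_item_pulls L \<pi> ?w e n) sequentially"
      using that by (intro eventually_ball_finite) auto
    \<comment> \<open>From 2 on, \<open>ln n\<close> is positive and can be divided by.\<close>
    moreover have "eventually (\<lambda>n. 2 \<le> n) sequentially" by (rule eventually_ge_at_top)
    ultimately show "eventually (\<lambda>n. ereal (?C * \<eta>) \<le> ereal (?R n / ln n)) sequentially"
    proof eventually_elim
      case (elim n)
      have "?C * (\<eta> * ln n) = \<Delta> * (1 - p) ^ (K - 1) * (\<Sum>e\<in>{K<..L}. \<eta> * ln n)"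
        using assms(2) by (simp add: of_nat_diff)
      also have "\<dots> \<le> \<Delta> * (1 - p) ^ (K - 1) * (\<Sum>e\<in>{K<..L}. expected_item_pulls L \<pi> ?w e n)"
        using assms elim by (intro mult_left_mono sum_mono) auto
      also have "\<dots> \<le> ?R n" using assms by (intro expected_regret_LB_ge)
      finally show ?case using elim by (simp add: field_simps)
    qed
  qed
  show ?thesis
  proof (cases "p = 1")
    case True
    \<comment> \<open>For \<open>p = 1\<close> the divergence is infinite and the claimed bound is
      0, so the trivial rate \<eta> = 0 suffices.\<close>
    have "0 \<le> expected_item_pulls L \<pi> ?w e n" for e n
      using assms by (auto simp: expected_item_pulls_def item_pulls_nonneg intro: integral_nonneg)
    then have "ereal (?C * 0) \<le> liminf (\<lambda>n. ereal (?R n / ln n))"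
      by (intro liminf_ge) auto
    then show ?thesis using True assms by (simp add: bernoulli_KL_def divide_ereal_def zero_ereal_def)
  next
    case False
    then have p: "p < 1" using assms by simp
    let ?D = "real_bernoulli_KL (p - \<Delta>) p"
    have D: "0 < ?D" using assms p by (intro real_bernoulli_KL_pos) auto
    have "bernoulli_KL (p - \<Delta>) p = ereal ?D"
      using assms p by (simp add: bernoulli_KL_def real_bernoulli_KL_def)
    then have goal: "ereal ?C / bernoulli_KL (p - \<Delta>) p = ereal (?C * (1 / ?D))"
      using D by simp
    have "ereal (?C * \<eta>) \<le> liminf (\<lambda>n. ereal (?R n / ln n))" if \<eta>: "0 < \<eta>" "\<eta> < 1 / ?D" for \<eta>
    proof (rule liminf_ge)
      fix e assume e: "e \<in> {K<..L}"
      then have we: "?w e = p - \<Delta>" by (simp add: LB_probs_def)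
      have "?w a \<le> p" for a using assms by (simp add: LB_probs_def)
      then show "eventually (\<lambda>n. \<eta> * ln n \<le> expected_item_pulls L \<pi> ?w e n) sequentially"
        using assms p e \<eta> D
        by (intro expected_item_pulls_ge_log[where K = K and p = p])
          (auto simp: we field_simps intro: LB_suboptimal LB_attraction_probs)
    qed
    \<comment> \<open>The bound holds for every rate strictly below \<open>1 / ?D\<close>; letting
      \<eta> increase to this value preserves the weak inequality.\<close>
    moreover have "eventually (\<lambda>\<eta>. 0 < \<eta> \<and> \<eta> < 1 / ?D) (at_left (1 / ?D))"
      using D unfolding eventually_at_left_field by (intro exI[of _ 0]) simp
    ultimately have "eventually (\<lambda>\<eta>. ereal (?C * \<eta>) \<le> liminf (\<lambda>n. ereal (?R n / ln n)))
        (at_left (1 / ?D))"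
      by (auto elim: eventually_mono)
    moreover have "((\<lambda>\<eta>. ereal (?C * \<eta>)) \<longlongrightarrow> ereal (?C * (1 / ?D))) (at_left (1 / ?D))"
      by (intro tendsto_intros)
    ultimately show ?thesis
      unfolding goal by (intro tendsto_upperbound) auto
  qed
qed

end
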